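(* Let $2\le k\le n$. For every strong digraph $D$ of order $n$, $1\le\kappa_k(D)\le n-1$. Moreover, both bounds are sharp, and $\kappa_k(D)=n-1$ holds if and only if $D\cong\overleftrightarrow{K}_n$ and $k\notin\{4,6\}$.
   Context: Digraphs are finite, without loops and without parallel arcs. $\overleftrightarrow{K}_n$ is the complete digraph on $n$ vertices (both arcs $uv$ and $vu$ for every pair of distinct vertices). A digraph is strong if for every ordered pair of vertices $u,v$ there is a directed path from $u$ to $v$; a one-vertex digraph is strong. For $S\subseteq V(D)$, strong subgraphs $D_1,\dots,D_p$ each containing $S$ are $S$-internally disjoint if $V(D_i)\cap V(D_j)=S$ and $A(D_i)\cap A(D_j)=\emptyset$ for all $i<j$. $\kappa_S(D)$ is the maximum number of $S$-internally disjoint strong subgraphs containing $S$, and $\kappa_k(D)=\min\{\kappa_S(D): S\subseteq V(D),\ |S|=k\}$. *)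

theory Defs
  imports Main
begin

text \<open>A digraph is a pair (V, A) of a finite vertex set and an arc set A \<subseteq> V \<times> V
  without loops (parallel arcs are excluded automatically since A is a set).\<close>
definition digraph :: "'a set \<Rightarrow> ('a \<times> 'a) set \<Rightarrow> bool" where
  "digraph V A \<longleftrightarrow> finite V \<and> A \<subseteq> V \<times> V \<and> (\<forall>v. (v, v) \<notin> A)"

text \<open>Strong: every ordered pair of vertices is joined by a directed path
  (a one-vertex digraph is strong; so is, vacuously, the empty one).\<close>
definition strong :: "'a set \<Rightarrow> ('a \<times> 'a) set \<Rightarrow> bool" where
  "strong V A \<longleftrightarrow> (\<forall>u\<in>V. \<forall>v\<in>V. (u, v) \<in> A\<^sup>*)"

definition subdigraph :: "'a set \<Rightarrow> ('a \<times> 'a) set \<Rightarrow> 'a set \<Rightarrow> ('a \<times> 'a) set \<Rightarrow> bool" where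
  "subdigraph V' A' V A \<longleftrightarrow> V' \<subseteq> V \<and> A' \<subseteq> A \<and> A' \<subseteq> V' \<times> V'"

text \<open>A family of p strong subgraphs D_0,...,D_{p-1} of (V,A), each containing S,
  that are S-internally disjoint.\<close>
definition S_internally_disjoint_family ::
  "'a set \<Rightarrow> ('a \<times> 'a) set \<Rightarrow> 'a set \<Rightarrow> nat \<Rightarrow> (nat \<Rightarrow> 'a set \<times> ('a \<times> 'a) set) \<Rightarrow> bool" where
  "S_internally_disjoint_family V A S p Ds \<longleftrightarrow>
     (\<forall>i<p. subdigraph (fst (Ds i)) (snd (Ds i)) V A \<and> strong (fst (Ds i)) (snd (Ds i))
             \<and> S \<subseteq> fst (Ds i)) \<and>
     (\<forall>i<p. \<forall>j<p. i < j \<longrightarrow> fst (Ds i) \<inter> fst (Ds j) = S \<and> snd (Ds i) \<inter> snd (Ds j) = {})"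

definition kappa_S :: "'a set \<Rightarrow> ('a \<times> 'a) set \<Rightarrow> 'a set \<Rightarrow> nat" where
  "kappa_S V A S = (GREATEST p. \<exists>Ds. S_internally_disjoint_family V A S p Ds)"

definition kappa_k :: "'a set \<Rightarrow> ('a \<times> 'a) set \<Rightarrow> nat \<Rightarrow> nat" where
  "kappa_k V A k = Min {kappa_S V A S | S. S \<subseteq> V \<and> card S = k}"

text \<open>The complete digraph on the vertex set {0..<n}.\<close>
definition complete_digraph_arcs :: "nat \<Rightarrow> (nat \<times> nat) set" where
  "complete_digraph_arcs n = {(i, j). i < n \<and> j < n \<and> i \<noteq> j}"

definition digraph_iso ::
  "'a set \<Rightarrow> ('a \<times> 'a) set \<Rightarrow> 'b set \<Rightarrow> ('b \<times> 'b) set \<Rightarrow> bool" where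
  "digraph_iso V A W B \<longleftrightarrow> (\<exists>f. bij_betw f V W \<and>
      (\<forall>u\<in>V. \<forall>v\<in>V. (u, v) \<in> A \<longleftrightarrow> (f u, f v) \<in> B))"

end

theory Submission
  imports Defs
begin

text \<open>Every member of a family uses up an arc leaving s, for each s in S, so a family has at most
  n - 1 members, and n - 1 for all S forces the digraph to be complete. In the complete digraph a vertex
  outside S contributes the bidirected star joining it to S, and by the count of out-degrees the
  remaining k - 1 members are arc-disjoint Hamiltonian cycles of S. So the claim reduces to Tillson's
  theorem: the complete digraph on k vertices decomposes into Hamiltonian cycles iff k is not 4 or 6.
  For odd k take Walecki's cycles in both directions. For even k = 2r + 2 with r at least 3, the cycles
  on 2r + 1 vertices admit a Hamiltonian path with exactly one arc in each cycle; a further vertex is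
  inserted into every cycle at its path arc, and the path closed up through the new vertex is the last
  cycle. For k = 4 and k = 6 a finite search excludes a decomposition.\<close>

section \<open>Arc-disjoint strong spanning subgraphs\<close>

text \<open>From \<open>z i\<close> walk forward to \<open>z m\<close>, take the closing arc to
  \<open>z 0\<close>, then walk forward to \<open>z j\<close>.\<close>

lemma strong_if_cyclic:
  assumes step: "\<And>i. i < m \<Longrightarrow> (z i, z (Suc i)) \<in> A"
    and close: "(z m, z 0) \<in> A" and cover: "V \<subseteq> z ` {..m}"
  shows "strong V A"
proof -
  have fwd: "j \<le> m \<Longrightarrow> (z i, z j) \<in> A\<^sup>*" if "i \<le> j" for i j
    using that
  proof (induction j rule: dec_induct)
    case (step j)
    then show ?case using assms(1)[of j] by (auto intro: rtrancl.rtrancl_into_rtrancl)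
  qed simp
  have "(z i, z j) \<in> A\<^sup>*" if "i \<le> m" "j \<le> m" for i j
    using fwd[of i m] fwd[of 0 j] close that by (meson le0 le_refl r_into_rtrancl rtrancl_trans)
  moreover have "\<exists>i\<le>m. v = z i" if "v \<in> V" for v using cover that by auto
  ultimately show ?thesis unfolding strong_def by metis
qed

text \<open>Each use of the deleted arc is rerouted through \<open>w\<close>, so reachability within
  \<open>S\<close> survives; \<open>w\<close> is entered from \<open>u\<close> and left towards
  \<open>v\<close>.\<close>

lemma strong_subdivide:
  assumes "strong S A" "(u, v) \<in> A" "u \<in> S" "v \<in> S"
  shows "strong (insert w S) (A - {(u, v)} \<union> {(u, w), (w, v)})" (is "strong _ ?B")
proof -
  have uv: "(u, w) \<in> ?B\<^sup>*" "(w, v) \<in> ?B\<^sup>*" by auto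
  then have "(u, v) \<in> ?B\<^sup>*" by (rule rtrancl_trans)
  then have "A \<subseteq> ?B\<^sup>*" by auto
  then have "A\<^sup>* \<subseteq> ?B\<^sup>*" by (rule rtrancl_subset_rtrancl)
  then have *: "(x, y) \<in> ?B\<^sup>*" if "x \<in> S" "y \<in> S" for x y
    using assms(1) that by (auto simp: strong_def)
  have "(x, w) \<in> ?B\<^sup>*" "(w, x) \<in> ?B\<^sup>*" if "x \<in> S" for x
    using *[OF that assms(3)] *[OF assms(4) that] uv by (auto intro: rtrancl_trans)
  with * show ?thesis by (auto simp: strong_def)
qed

text \<open>Strong spanning subgraphs stand in for Hamiltonian cycles. With
  \<open>m = card S - 1\<close> nothing is lost: every member needs an arc out of each vertex, only
  \<open>card S - 1\<close> such arcs exist, so each member has out-degree 1 and is a Hamiltonian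
  cycle.\<close>

definition arc_split :: "'a set \<Rightarrow> nat \<Rightarrow> (nat \<Rightarrow> ('a \<times> 'a) set) \<Rightarrow> bool" where
  "arc_split S m F \<longleftrightarrow> (\<forall>i<m. F i \<subseteq> S \<times> S - Id \<and> strong S (F i)) \<and>
     (\<forall>i<m. \<forall>j<m. i \<noteq> j \<longrightarrow> F i \<inter> F j = {})"

lemma arc_splitD:
  assumes "arc_split S m F" "i < m"
  shows "F i \<subseteq> S \<times> S - Id" "strong S (F i)" "j < m \<Longrightarrow> x \<in> F i \<Longrightarrow> x \<in> F j \<Longrightarrow> i = j"
proof -
  show "F i \<subseteq> S \<times> S - Id" "strong S (F i)" using assms by (simp_all add: arc_split_def)
  show "i = j" if "j < m" "x \<in> F i" "x \<in> F j" using assms that unfolding arc_split_def by blast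
qed

text \<open>The path p takes one arc from each of the m subgraphs. The new vertex w subdivides each of
  these arcs in its own subgraph, and the arcs so released, closed up through w, form one more cycle.\<close>
lemma arc_split_insert:
  assumes F: "arc_split S m F" and "w \<notin> S"
    and p: "inj_on p {..m}" "p ` {..m} = S"
    and g: "inj_on g {..<m}" "g ` {..<m} \<subseteq> {..<m}"
    and pg: "\<And>t. t < m \<Longrightarrow> (p t, p (Suc t)) \<in> F (g t)"
  shows "\<exists>G. arc_split (insert w S) (Suc m) G"
proof -
  define P where "P = {(p t, p (Suc t)) |t. t < m} \<union> {(p m, w), (w, p 0)}"
  \<comment> \<open>Members are reindexed along the path: member \<open>t < m\<close> comes from
    \<open>F (g t)\<close>, the subgraph that owns arc number \<open>t\<close> of the path.\<close>
  define G where "G t = (if t < m then F (g t) - {(p t, p (Suc t))} \<union> {(p t, w), (w, p (Suc t))}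
    else P)" for t
  have gm: "g t < m" if "t < m" for t using g that by auto
  have pS: "p t \<in> S" if "t \<le> m" for t using p that by auto
  have pinj: "p s = p t \<longleftrightarrow> s = t" if "s \<le> m" "t \<le> m" for s t
    using p(1) that by (auto simp: inj_on_def)
  note FD = arc_splitD[OF F gm]
  have ginj: "g s = g t \<longleftrightarrow> s = t" if "s < m" "t < m" for s t
    using g(1) that by (auto simp: inj_on_def)
  have sub: "G t \<subseteq> insert w S \<times> insert w S - Id" if "t < Suc m" for t
  proof (cases "t < m")
    case True
    then show ?thesis using FD(1)[OF True] pS[of t] pS[of "Suc t"] \<open>w \<notin> S\<close>
      by (auto simp: G_def)
  next
    case False
    then show ?thesis using pS \<open>w \<notin> S\<close> by (fastforce simp: G_def P_def pinj)
  qed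
  have str: "strong (insert w S) (G t)" if "t < Suc m" for t
  proof (cases "t < m")
    case True
    then show ?thesis
      using strong_subdivide[OF FD(2)[OF True] pg[OF True]] pS by (simp add: G_def)
  next
    case False
    have "strong (insert w S) P"
    proof (rule strong_if_cyclic[where m = "Suc m" and z = "\<lambda>i. if i \<le> m then p i else w"])
      show "insert w S \<subseteq> (\<lambda>i. if i \<le> m then p i else w) ` {..Suc m}"
        using p(2) by (force simp: image_iff)
    qed (auto simp: P_def le_less_Suc_eq)
    then show ?thesis using False by (simp add: G_def)
  qed
  have old: "x \<in> S \<and> y \<in> S" if "t < m" "(x, y) \<in> F (g t)" for x y t
    using FD(1)[OF that(1)] that(2) by auto
  have disj1: "G s \<inter> G t = {}" if "s < m" "t < m" "s \<noteq> t" for s t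
  proof -
    have "F (g s) \<inter> F (g t) = {}" using FD(3)[OF that(1) gm[OF that(2)]] ginj that by auto
    moreover have "p s \<noteq> p t" "p (Suc s) \<noteq> p (Suc t)" using that by (simp_all add: pinj)
    ultimately show ?thesis using that old pS \<open>w \<notin> S\<close> by (auto simp: G_def)
  qed
  \<comment> \<open>Arc number \<open>t\<close> of the path lies in \<open>F (g t)\<close> alone,
    and was removed there. The subdivided members enter \<open>w\<close> from \<open>p 0\<close>,
    ..., \<open>p (m - 1)\<close> and leave it to \<open>p 1\<close>, ..., \<open>p m\<close>, which
    leaves \<open>(p m, w)\<close> and \<open>(w, p 0)\<close> free for \<open>P\<close>.\<close>
  have disj2: "G s \<inter> P = {}" if "s < m" for s
  proof -
    have "(p t, p (Suc t)) \<notin> G s" if "t < m" for t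
      using pg[OF that] FD(3)[OF that gm[OF \<open>s < m\<close>]] ginj[OF that \<open>s < m\<close>]
        pS[of t] pS[of "Suc t"] that \<open>s < m\<close> \<open>w \<notin> S\<close> by (auto simp: G_def)
    moreover have "(p m, w) \<notin> G s" "(w, p 0) \<notin> G s"
      using that old[OF that] pS[of m] pS[of 0] pS[of s] pS[of "Suc s"] \<open>w \<notin> S\<close> by (auto simp: G_def pinj)
    ultimately show ?thesis by (auto simp: P_def)
  qed
  have GP: "G t = P" if "\<not> t < m" for t using that by (simp add: G_def)
  have "G s \<inter> G t = {}" if "s < Suc m" "t < Suc m" "s \<noteq> t" for s t
  proof (cases "s < m")
    case True
    then show ?thesis using disj1[of s t] disj2[of s] GP[of t] that by (cases "t < m") simp_all
  next
    case False
    then have "t < m" "G s = P" using that GP by simp_all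
    then show ?thesis using disj2[of t] by (simp add: Int_commute)
  qed
  then have "arc_split (insert w S) (Suc m) G" using sub str by (simp add: arc_split_def)
  then show ?thesis by blast
qed

lemma arc_split_transfer:
  assumes F: "arc_split S m F" and f: "bij_betw f S T"
  shows "\<exists>G. arc_split T m G"
proof -
  define G where "G i = map_prod f f ` F i" for i
  have inj: "inj_on f S" and im: "f ` S = T" using f by (auto simp: bij_betw_def)
  have sub: "F i \<subseteq> S \<times> S - Id" if "i < m" for i using arc_splitD(1)[OF F that] .
  have "G i \<subseteq> T \<times> T - Id" if "i < m" for i
    using sub[OF that] im inj by (fastforce simp: G_def inj_on_def)
  moreover have "strong T (G i)" if "i < m" for i
  proof -
    have lift: "(f x, f y) \<in> (G i)\<^sup>*" if "(x, y) \<in> (F i)\<^sup>*" for x y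
      using that by induction (auto simp: G_def intro: rtrancl.rtrancl_into_rtrancl)
    show ?thesis using arc_splitD(2)[OF F that] im lift by (force simp: strong_def)
  qed
  moreover have "G i \<inter> G j = {}" if "i < m" "j < m" "i \<noteq> j" for i j
  proof -
    have "inj_on (map_prod f f) (S \<times> S)" using inj by (auto simp: inj_on_def)
    then have "G i \<inter> G j = map_prod f f ` (F i \<inter> F j)"
      unfolding G_def using sub that by (intro inj_on_image_Int[symmetric]) auto
    also have "F i \<inter> F j = {}" using arc_splitD(3)[OF F] that by blast
    finally show ?thesis by simp
  qed
  ultimately have "arc_split T m G" by (simp add: arc_split_def)
  then show ?thesis by blast
qed

section \<open>Walecki cycles and rainbow Hamiltonian paths\<close>

text \<open>Walecki's decomposition on the residues modulo 2r and a point at infinity, encoded as 2 * r: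
  the c-th cycle is infinity, c, c+1, c-1, c+2, ..., c+r, and the class of an arc is the index of the
  cycle through it. A step from x by d, where 0 < d < 2r, lies in the cycle
  x + (d - 1)/2 if d is odd and x + d/2 + r if d is even.\<close>
definition walecki_class :: "nat \<Rightarrow> nat \<Rightarrow> nat \<Rightarrow> nat" where
  "walecki_class r x y =
     (if x = 2 * r then y else if y = 2 * r then (x + r) mod (2 * r)
      else let d = (y + 2 * r - x) mod (2 * r)
        in (x + d div 2 + (if even d then r else 0)) mod (2 * r))"

definition walecki_cycle :: "nat \<Rightarrow> nat \<Rightarrow> (nat \<times> nat) set" where
  "walecki_cycle r c = {(x, y). x \<le> 2 * r \<and> y \<le> 2 * r \<and> x \<noteq> y \<and> walecki_class r x y = c}"

text \<open>This and the next lemma remove the inner modulus, so that the classes along an explicit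
  path become linear arithmetic.\<close>

lemma walecki_class_less:
  "x < y \<Longrightarrow> y < 2 * r \<Longrightarrow>
    walecki_class r x y = (x + (y - x) div 2 + (if even (y - x) then r else 0)) mod (2 * r)"
proof -
  assume *: "x < y" "y < 2 * r"
  then have "(y + 2 * r - x) mod (2 * r) = (y - x + 2 * r) mod (2 * r)" by simp
  also have "\<dots> = y - x" using * by (simp only: mod_add_self2) simp
  finally show ?thesis using * by (simp add: walecki_class_def)
qed

lemma walecki_class_greater:
  "y < x \<Longrightarrow> x < 2 * r \<Longrightarrow>
    walecki_class r x y = (x + (y + 2 * r - x) div 2 + (if even (y + 2 * r - x) then r else 0)) mod (2 * r)"
proof -
  assume *: "y < x" "x < 2 * r"
  then have "(y + 2 * r - x) mod (2 * r) = y + 2 * r - x" by (intro mod_less) linarith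
  then show ?thesis using * by (simp add: walecki_class_def Let_def)
qed

text \<open>These are the arcs of cycle c from c - j to c + j + 1: the step is 2j + 1, and adding j
  to the tail recovers c.\<close>

lemma walecki_class_odd:
  assumes "x < 2 * r" "j < r"
  shows "walecki_class r x ((x + (2 * j + 1)) mod (2 * r)) = (x + j) mod (2 * r)"
    and "(x + (2 * j + 1)) mod (2 * r) \<noteq> x"
proof -
  have *: "(x + (2 * j + 1)) mod (2 * r) =
    (if x + (2 * j + 1) < 2 * r then x + (2 * j + 1) else x + (2 * j + 1) - 2 * r)"
    using assms by (simp add: mod_if)
  show "walecki_class r x ((x + (2 * j + 1)) mod (2 * r)) = (x + j) mod (2 * r)"
    unfolding * using assms by (auto simp: walecki_class_less walecki_class_greater)
  show "(x + (2 * j + 1)) mod (2 * r) \<noteq> x" unfolding * using assms by auto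
qed

text \<open>These are the arcs of cycle c from c + i back to c - i, with \<open>j = r - i\<close>:
  modulo 2r the step is 2(r - i), and adding (r - i) + r to the tail gives c again.\<close>

lemma walecki_class_even:
  assumes "x < 2 * r" "0 < j" "j < r"
  shows "walecki_class r x ((x + 2 * j) mod (2 * r)) = (x + j + r) mod (2 * r)"
    and "(x + 2 * j) mod (2 * r) \<noteq> x"
proof -
  have *: "(x + 2 * j) mod (2 * r) = (if x + 2 * j < 2 * r then x + 2 * j else x + 2 * j - 2 * r)"
    using assms by (simp add: mod_if)
  show "walecki_class r x ((x + 2 * j) mod (2 * r)) = (x + j + r) mod (2 * r)"
    unfolding * using assms by (auto simp: walecki_class_less walecki_class_greater)
  show "(x + 2 * j) mod (2 * r) \<noteq> x" unfolding * using assms by auto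
qed

lemma strong_walecki_cycle:
  assumes "c < 2 * r"
  shows "strong {..2 * r} (walecki_cycle r c)"
proof -
  define N where "N = 2 * r"
  have r: "0 < r" "0 < N" and cN: "c < N" using assms by (auto simp: N_def)
  \<comment> \<open>The zigzag in order: infinity at position 0, c - j at position 2j + 1, c + j at
    position 2j for positive j. Adding \<open>N\<close> first avoids truncated subtraction.\<close>
  define z where "z i = (if i = 0 then N else if odd i then (c + N - i div 2) mod N
    else (c + i div 2) mod N)" for i
  show ?thesis
  proof (rule strong_if_cyclic[where m = "2 * r" and z = z])
    fix i assume i: "i < 2 * r"
    consider "i = 0" | j where "i = 2 * j + 1" | j where "i = 2 * j" "0 < j"
      by (metis evenE oddE mult_0_right neq0_conv)
    then show "(z i, z (Suc i)) \<in> walecki_cycle r c"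
    proof cases
      case 1
      then show ?thesis using cN by (auto simp: z_def walecki_cycle_def walecki_class_def N_def)
    next
      case 2
      define x where "x = (c + N - j) mod N"
      have j: "j < r" "j < N" using 2 i by (auto simp: N_def)
      have x: "x < N" using r by (simp add: x_def)
      have "(x + (2 * j + 1)) mod N = (c + N - j + (2 * j + 1)) mod N" by (simp only: x_def mod_add_left_eq)
      also have "c + N - j + (2 * j + 1) = c + Suc j + N" using j by simp
      finally have y: "(x + (2 * j + 1)) mod N = (c + Suc j) mod N" by (simp only: mod_add_self2)
      have "(x + j) mod N = (c + N - j + j) mod N" by (simp only: x_def mod_add_left_eq)
      also have "c + N - j + j = c + N" using j by simp
      finally have "(x + j) mod N = c" using cN by simp
      moreover have "z i = x" "z (Suc i) = (c + Suc j) mod N" using 2 by (simp_all add: z_def x_def)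
      moreover have "(c + Suc j) mod N < N" using r by simp
      ultimately show ?thesis using walecki_class_odd[of x r j] x j y
        by (simp add: walecki_cycle_def N_def)
    next
      case 3
      define x where "x = (c + j) mod N"
      have j: "r - j < r" "0 < r - j" "j < N" using 3 i by (auto simp: N_def)
      have x: "x < N" using r by (simp add: x_def)
      have "(x + 2 * (r - j)) mod N = (c + j + 2 * (r - j)) mod N" by (simp only: x_def mod_add_left_eq)
      also have "c + j + 2 * (r - j) = c + N - j" using j by (simp add: N_def)
      finally have y: "(x + 2 * (r - j)) mod N = (c + N - j) mod N" .
      have "(x + (r - j) + r) mod N = (c + j + (r - j + r)) mod N"
        by (simp only: x_def mod_add_left_eq add.assoc)
      also have "c + j + (r - j + r) = c + N" using j by (simp add: N_def)
      finally have "(x + (r - j) + r) mod N = c" using cN by simp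
      moreover have "z i = x" "z (Suc i) = (c + N - j) mod N" using 3 by (simp_all add: z_def x_def)
      moreover have "(c + N - j) mod N < N" using r by simp
      ultimately show ?thesis using walecki_class_even[of x r "r - j"] x j y
        by (simp add: walecki_cycle_def N_def)
    qed
  next
    \<comment> \<open>The closing arc runs from c + r to infinity, and its class is c + r + r, which
      is c modulo 2r.\<close>
    have "(c + r) mod N < N" using r by simp
    then have x: "(c + r) mod N \<noteq> N" "(c + r) mod N \<le> N" by simp_all
    have "walecki_class r ((c + r) mod N) N = (c + r + r) mod N"
      using x by (simp only: walecki_class_def N_def mod_add_left_eq if_False simp_thms if_True)
    also have "\<dots> = c" using cN by (simp add: N_def mult_2 add.assoc)
    finally show "(z (2 * r), z 0) \<in> walecki_cycle r c"
      using r x by (simp add: z_def walecki_cycle_def N_def)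
  next
    show "{..2 * r} \<subseteq> z ` {..2 * r}"
    proof
      fix x assume "x \<in> {..2 * r}"
      then consider "x = N" | "x < N" by (force simp: N_def)
      then show "x \<in> z ` {..2 * r}"
      proof cases
        case 1
        then have "x = z 0" by (simp add: z_def)
        then show ?thesis by blast
      next
        case 2
        \<comment> \<open>The offset of \<open>x\<close> from \<open>c\<close> determines its
          position: offsets 1 to r occur at even positions, while 0 and the offsets above r occur at
          odd ones, as descents by \<open>N - d\<close>.\<close>
        define d where "d = (x + N - c) mod N"
        have dN: "d < N" using r by (simp add: d_def)
        have "(c + d) mod N = (c + (x + N - c)) mod N" by (simp add: d_def mod_simps)
        also have "c + (x + N - c) = x + N" using cN by simp
        finally have d: "(c + d) mod N = x" using 2 by simp
        show ?thesis
        proof (cases "0 < d \<and> d \<le> r")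
          case True
          then have "z (2 * d) = x" using d by (simp add: z_def)
          then show ?thesis using True by force
        next
          case False
          define j where "j = (if d = 0 then 0 else N - d)"
          have j: "j < r" using False dN by (auto simp: j_def N_def)
          have "(c + N - j) mod N = (c + d) mod N" using dN by (auto simp: j_def)
          then have "z (2 * j + 1) = x" using d by (simp add: z_def)
          moreover have "2 * j + 1 \<le> 2 * r" using j by simp
          ultimately show ?thesis by blast
        qed
      qed
    qed
  qed
qed

text \<open>The cycles are fibres of \<open>walecki_class\<close>, so disjointness is immediate.
  Cycle c + r is the reverse of cycle c, hence these are r undirected cycles in both
  directions.\<close>

lemma arc_split_walecki: "arc_split {..2 * r} (2 * r) (walecki_cycle r)"
  using strong_walecki_cycle by (auto simp: arc_split_def walecki_cycle_def)

text \<open>The path 0, 1, 3, ..., 2r-1, infinity, r+1, r+3, ..., 2r-2, 2, 4, ..., r-1. All but four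
  of its steps are +2, so its classes advance by 2 along each stretch. Here and in the even case
  the maps h and k are left inverses that witness injectivity of the path and of its arc classes;
  the paths were found by computer search.\<close>
lemma rainbow_path_odd:
  assumes "0 < q" "r = 2 * q + 1"
  shows "\<exists>p h k. (\<forall>t\<le>2 * r. p t \<le> 2 * r \<and> h (p t) = t) \<and>
    (\<forall>t<2 * r. walecki_class r (p t) (p (Suc t)) < 2 * r \<and> k (walecki_class r (p t) (p (Suc t))) = t)"
proof -
  define p where "p t = (if t = 0 then 0 else if t \<le> r then 2 * t - 1 else if t = r + 1 then 2 * r
    else if t \<le> r + 1 + q then 2 * t - r - 3 else 2 * (t - r - 1 - q))" for t
  define h where "h v = (if v = 0 then 0 else if v = 2 * r then r + 1 else if odd v then (v + 1) div 2
    else if v < r then v div 2 + r + 1 + q else (v + r + 3) div 2)" for v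
  define k where "k c = (if c = 0 then 0 else if odd c
    then (if c = r then r + q + 1 else if c > r then (c - r) div 2 else (c + r) div 2)
    else if c = r - 1 then r else if c = r + 1 then r + 1 else if c < r then c div 2 + r + 1 else c div 2 + r)" for c
  \<comment> \<open>Writing \<open>q\<close> as a successor lets the simplifier evaluate the
    comparisons and truncated subtractions in \<open>p\<close>, \<open>h\<close> and
    \<open>k\<close>.\<close>
  obtain s where s: "q = s + 1" using assms(1) by (metis Suc_pred' Suc_eq_plus1)
  have "p t \<le> 2 * r \<and> h (p t) = t" if "t \<le> 2 * r" for t
  proof -
    from that consider "t = 0"
      | u where "t = u + 1" "u < r"
      | "t = r + 1"
      | u where "t = r + 2 + u" "u < q"
      | u where "t = r + 2 + q + u" "u < q"
      using assms by atomize_elim presburger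
    then show ?thesis
    proof cases
      case 1
      then have "p t = 0" using assms(2) s by (simp add: p_def)
      moreover have "h 0 = 0" using 1 assms(2) s by (simp add: h_def)
      ultimately show ?thesis using 1 assms(2) s by simp
    next
      case 2
      then have "p t = 2 * u + 1" using assms(2) s by (simp add: p_def)
      moreover have "h (2 * u + 1) = u + 1" using 2 assms(2) s by (simp add: h_def)
      ultimately show ?thesis using 2 assms(2) s by simp
    next
      case 3
      then have "p t = 2 * r" using assms(2) s by (simp add: p_def)
      moreover have "h (2 * r) = r + 1" using 3 assms(2) s by (simp add: h_def)
      ultimately show ?thesis using 3 assms(2) s by simp
    next
      case 4
      then have "p t = 2 * (q + 1 + u)" using assms(2) s by (simp add: p_def)
      moreover have "h (2 * (q + 1 + u)) = r + 2 + u" using 4 assms(2) s by (simp add: h_def)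
      ultimately show ?thesis using 4 assms(2) s by simp
    next
      case 5
      then have "p t = 2 * (u + 1)" using assms(2) s by (simp add: p_def)
      moreover have "h (2 * (u + 1)) = r + 2 + q + u" using 5 assms(2) s by (simp add: h_def)
      ultimately show ?thesis using 5 assms(2) s by simp
    qed
  qed
  moreover have "walecki_class r (p t) (p (Suc t)) < 2 * r \<and> k (walecki_class r (p t) (p (Suc t))) = t"
    if "t < 2 * r" for t
  proof -
    \<comment> \<open>A step +2 from x has class x + 1 + r modulo 2r. The odd stretch is cut where
      this passes 2r; it yields all odd classes but r, which comes from the jump from 2r - 2 to 2.
      The even stretches miss only 0, r - 1 and r + 1, which come from the arc from 0 to 1 and the
      arcs into and out of infinity.\<close>
    from that consider "t = 0"
      | u where "t = u + 1" "u < q"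
      | u where "t = q + 1 + u" "u < q"
      | "t = r"
      | "t = r + 1"
      | u where "t = r + 2 + u" "u + 1 < q"
      | "t = r + 1 + q"
      | u where "t = r + 2 + q + u" "u + 1 < q"
      using assms by atomize_elim presburger
    then show ?thesis
    proof cases
      case 1
      then have "p t = 0" "p (Suc t) = 1"
        using assms(2) s by (simp_all add: p_def)
      moreover have "walecki_class r 0 1 = 0 mod (2 * r)"
        using 1 assms(2) s by (subst walecki_class_less) (auto simp: add.commute)
      moreover have "0 < 2 * r" using 1 assms(2) s by simp
      moreover have "k 0 = 0" using 1 assms(2) s by (simp add: k_def)
      ultimately show ?thesis using 1 by simp
    next
      case 2
      then have "p t = 2 * u + 1" "p (Suc t) = 2 * u + 3"
        using assms(2) s by (simp_all add: p_def)
      moreover have "walecki_class r (2 * u + 1) (2 * u + 3) = (2 * (u + q + 1) + 1) mod (2 * r)"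
        using 2 assms(2) s by (subst walecki_class_less) (auto simp: add.commute)
      moreover have "2 * (u + q + 1) + 1 < 2 * r" using 2 assms(2) s by simp
      moreover have "k (2 * (u + q + 1) + 1) = u + 1" using 2 assms(2) s by (simp add: k_def)
      ultimately show ?thesis using 2 by simp
    next
      case 3
      then have "p t = 2 * (u + q) + 1" "p (Suc t) = 2 * (u + q) + 3"
        using assms(2) s by (simp_all add: p_def)
      moreover have "walecki_class r (2 * (u + q) + 1) (2 * (u + q) + 3) = (2 * u + 1 + 2 * r) mod (2 * r)"
        using 3 assms(2) s by (subst walecki_class_less) (auto simp: add.commute)
      moreover have "2 * u + 1 < 2 * r" using 3 assms(2) s by simp
      moreover have "k (2 * u + 1) = q + 1 + u" using 3 assms(2) s by (simp add: k_def)
      ultimately show ?thesis using 3 by (simp only: mod_add_self2 mod_less simp_thms)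
    next
      case 4
      then have "p t = 4 * q + 1" "p (Suc t) = 2 * r"
        using assms(2) s by (simp_all add: p_def)
      moreover have "walecki_class r (4 * q + 1) (2 * r) = 2 * q"
        using 4 assms(2) s by (simp add: walecki_class_def mod_if)
      moreover have "2 * q < 2 * r" using 4 assms(2) s by simp
      moreover have "k (2 * q) = r" using 4 assms(2) s by (simp add: k_def)
      ultimately show ?thesis using 4 by simp
    next
      case 5
      then have "p t = 2 * r" "p (Suc t) = 2 * (q + 1)"
        using assms(2) s by (simp_all add: p_def)
      moreover have "walecki_class r (2 * r) (2 * (q + 1)) = 2 * (q + 1)"
        using 5 assms(2) s by (simp add: walecki_class_def mod_if)
      moreover have "2 * (q + 1) < 2 * r" using 5 assms(2) s by simp
      moreover have "k (2 * (q + 1)) = r + 1" using 5 assms(2) s by (simp add: k_def)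
      ultimately show ?thesis using 5 by simp
    next
      case 6
      then have "p t = 2 * (q + 1 + u)" "p (Suc t) = 2 * (q + 2 + u)"
        using assms(2) s by (simp_all add: p_def)
      moreover have "walecki_class r (2 * (q + 1 + u)) (2 * (q + 2 + u)) = (2 * (u + 1) + 2 * r) mod (2 * r)"
        using 6 assms(2) s by (subst walecki_class_less) (auto simp: add.commute)
      moreover have "2 * (u + 1) < 2 * r" using 6 assms(2) s by simp
      moreover have "k (2 * (u + 1)) = r + 2 + u" using 6 assms(2) s by (simp add: k_def)
      ultimately show ?thesis using 6 by (simp only: mod_add_self2 mod_less simp_thms)
    next
      case 7
      then have "p t = 4 * q" "p (Suc t) = 2"
        using assms(2) s by (simp_all add: p_def)
      moreover have "walecki_class r (4 * q) 2 = (2 * q + 1 + 2 * r) mod (2 * r)"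
        using 7 assms(2) s by (subst walecki_class_greater) (auto simp: add.commute mod_if)
      moreover have "2 * q + 1 < 2 * r" using 7 assms(2) s by simp
      moreover have "k (2 * q + 1) = r + 1 + q" using 7 assms(2) s by (simp add: k_def)
      ultimately show ?thesis using 7 by (simp only: mod_add_self2 mod_less simp_thms)
    next
      case 8
      then have "p t = 2 * (u + 1)" "p (Suc t) = 2 * (u + 2)"
        using assms(2) s by (simp_all add: p_def)
      moreover have "walecki_class r (2 * (u + 1)) (2 * (u + 2)) = (2 * (u + q + 2)) mod (2 * r)"
        using 8 assms(2) s by (subst walecki_class_less) (auto simp: add.commute)
      moreover have "2 * (u + q + 2) < 2 * r" using 8 assms(2) s by simp
      moreover have "k (2 * (u + q + 2)) = r + 2 + q + u" using 8 assms(2) s by (simp add: k_def)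
      ultimately show ?thesis using 8 by simp
    qed
  qed
  ultimately show ?thesis by blast
qed

text \<open>The path infinity, 0, 2, ..., r-2, r-1, r, r+2, ..., 2r-2, 2r-1, 1, 3, ..., r-3, r+1, r+3, ...,
  2r-3.\<close>
lemma rainbow_path_even:
  assumes "2 \<le> q" "r = 2 * q"
  shows "\<exists>p h k. (\<forall>t\<le>2 * r. p t \<le> 2 * r \<and> h (p t) = t) \<and>
    (\<forall>t<2 * r. walecki_class r (p t) (p (Suc t)) < 2 * r \<and> k (walecki_class r (p t) (p (Suc t))) = t)"
proof -
  define p where "p t = (if t = 0 then 2 * r else if t \<le> q then 2 * t - 2 else if t = q + 1 then r - 1
    else if t \<le> r + 1 then 2 * t - 4 else if t = r + 2 then 2 * r - 1
    else if t \<le> r + q + 1 then 2 * t - 2 * r - 5 else 2 * t - 2 * r - 3)" for t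
  define h where "h v = (if v = 2 * r then 0 else if even v then (if v < r then v div 2 + 1 else v div 2 + 2)
    else if v = r - 1 then q + 1 else if v = 2 * r - 1 then r + 2
    else if v < r then (v + 2 * r + 5) div 2 else (v + 2 * r + 3) div 2)" for v
  define k where "k c = (if c = 0 then 0 else if odd c
    then (if c = r - 1 then q + 1 else if c = 2 * r - 1 then r + q + 1
      else if c < r then (c + 3 + r) div 2 else (c + 1 - r) div 2)
    else if c = r - 2 then q else if c = 2 * r - 2 then r + 1 else if c = r then r + 2
    else if c > r then (c + r + 4) div 2 else (c + 3 * r + 2) div 2)" for c
  obtain s where s: "q = s + 2" using assms(1) by (metis add.commute le_Suc_ex)
  have "p t \<le> 2 * r \<and> h (p t) = t" if "t \<le> 2 * r" for t
  proof -
    from that consider "t = 0"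
      | u where "t = u + 1" "u < q"
      | "t = q + 1"
      | u where "t = q + 2 + u" "u < q"
      | "t = 2 * q + 2"
      | u where "t = 2 * q + 3 + u" "u + 1 < q"
      | u where "t = 3 * q + 2 + u" "u + 1 < q"
      using assms by atomize_elim presburger
    then show ?thesis
    proof cases
      case 1
      then have "p t = 2 * r" using assms(2) s by (simp add: p_def)
      moreover have "h (2 * r) = 0" using 1 assms(2) s by (simp add: h_def)
      ultimately show ?thesis using 1 assms(2) s by simp
    next
      case 2
      then have "p t = 2 * u" using assms(2) s by (simp add: p_def)
      moreover have "h (2 * u) = u + 1" using 2 assms(2) s by (simp add: h_def)
      ultimately show ?thesis using 2 assms(2) s by simp
    next
      case 3
      then have "p t = 2 * s + 3" using assms(2) s by (simp add: p_def)
      moreover have "h (2 * s + 3) = q + 1" using 3 assms(2) s by (simp add: h_def)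
      ultimately show ?thesis using 3 assms(2) s by simp
    next
      case 4
      then have "p t = 2 * (q + u)" using assms(2) s by (simp add: p_def)
      moreover have "h (2 * (q + u)) = q + 2 + u" using 4 assms(2) s by (simp add: h_def)
      ultimately show ?thesis using 4 assms(2) s by simp
    next
      case 5
      then have "p t = 4 * s + 7" using assms(2) s by (simp add: p_def)
      moreover have "h (4 * s + 7) = 2 * q + 2" using 5 assms(2) s by (simp add: h_def)
      ultimately show ?thesis using 5 assms(2) s by simp
    next
      case 6
      then have "p t = 2 * u + 1" using assms(2) s by (simp add: p_def)
      moreover have "h (2 * u + 1) = 2 * q + 3 + u" using 6 assms(2) s by (simp add: h_def)
      ultimately show ?thesis using 6 assms(2) s by simp
    next
      case 7
      then have "p t = 2 * (q + u) + 1" using assms(2) s by (simp add: p_def)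
      moreover have "h (2 * (q + u) + 1) = 3 * q + 2 + u" using 7 assms(2) s by (simp add: h_def)
      ultimately show ?thesis using 7 assms(2) s by simp
    qed
  qed
  moreover have "walecki_class r (p t) (p (Suc t)) < 2 * r \<and> k (walecki_class r (p t) (p (Suc t))) = t"
    if "t < 2 * r" for t
  proof -
    \<comment> \<open>The four stretches of +2 steps yield every class except 0, r - 2, r - 1, r, 2r
      - 2 and 2r - 1. The six arcs joining the pieces supply these: infinity to 0 gives 0, the unit
      steps from r - 2, r - 1 and 2r - 2 give their own tails, 2r - 1 to 1 gives r, and r - 3 to r +
      1 gives 2r - 1.\<close>
    from that consider "t = 0"
      | u where "t = u + 1" "u + 1 < q"
      | "t = q"
      | "t = q + 1"
      | u where "t = q + 2 + u" "u + 1 < q"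
      | "t = 2 * q + 1"
      | "t = 2 * q + 2"
      | u where "t = 2 * q + 3 + u" "u + 2 < q"
      | "t = 3 * q + 1"
      | u where "t = 3 * q + 2 + u" "u + 2 < q"
      using assms by atomize_elim presburger
    then show ?thesis
    proof cases
      case 1
      then have "p t = 2 * r" "p (Suc t) = 0"
        using assms(2) s by (simp_all add: p_def)
      moreover have "walecki_class r (2 * r) 0 = 0"
        using 1 assms(2) s by (simp add: walecki_class_def mod_if)
      moreover have "0 < 2 * r" using 1 assms(2) s by simp
      moreover have "k 0 = 0" using 1 assms(2) s by (simp add: k_def)
      ultimately show ?thesis using 1 by simp
    next
      case 2
      then have "p t = 2 * u" "p (Suc t) = 2 * (u + 1)"
        using assms(2) s by (simp_all add: p_def)
      moreover have "walecki_class r (2 * u) (2 * (u + 1)) = (2 * (u + q) + 1) mod (2 * r)"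
        using 2 assms(2) s by (subst walecki_class_less) (auto simp: add.commute)
      moreover have "2 * (u + q) + 1 < 2 * r" using 2 assms(2) s by simp
      moreover have "k (2 * (u + q) + 1) = u + 1" using 2 assms(2) s by (simp add: k_def)
      ultimately show ?thesis using 2 by simp
    next
      case 3
      then have "p t = 2 * s + 2" "p (Suc t) = 2 * s + 3"
        using assms(2) s by (simp_all add: p_def)
      moreover have "walecki_class r (2 * s + 2) (2 * s + 3) = (2 * s + 2) mod (2 * r)"
        using 3 assms(2) s by (subst walecki_class_less) (auto simp: add.commute)
      moreover have "2 * s + 2 < 2 * r" using 3 assms(2) s by simp
      moreover have "k (2 * s + 2) = q" using 3 assms(2) s by (simp add: k_def)
      ultimately show ?thesis using 3 by simp
    next
      case 4
      then have "p t = 2 * s + 3" "p (Suc t) = 2 * s + 4"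
        using assms(2) s by (simp_all add: p_def)
      moreover have "walecki_class r (2 * s + 3) (2 * s + 4) = (2 * s + 3) mod (2 * r)"
        using 4 assms(2) s by (subst walecki_class_less) (auto simp: add.commute)
      moreover have "2 * s + 3 < 2 * r" using 4 assms(2) s by simp
      moreover have "k (2 * s + 3) = q + 1" using 4 assms(2) s by (simp add: k_def)
      ultimately show ?thesis using 4 by simp
    next
      case 5
      then have "p t = 2 * (q + u)" "p (Suc t) = 2 * (q + u + 1)"
        using assms(2) s by (simp_all add: p_def)
      moreover have "walecki_class r (2 * (q + u)) (2 * (q + u + 1)) = (2 * u + 1 + 2 * r) mod (2 * r)"
        using 5 assms(2) s by (subst walecki_class_less) (auto simp: add.commute)
      moreover have "2 * u + 1 < 2 * r" using 5 assms(2) s by simp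
      moreover have "k (2 * u + 1) = q + 2 + u" using 5 assms(2) s by (simp add: k_def)
      ultimately show ?thesis using 5 by (simp only: mod_add_self2 mod_less simp_thms)
    next
      case 6
      then have "p t = 4 * s + 6" "p (Suc t) = 4 * s + 7"
        using assms(2) s by (simp_all add: p_def)
      moreover have "walecki_class r (4 * s + 6) (4 * s + 7) = (4 * s + 6) mod (2 * r)"
        using 6 assms(2) s by (subst walecki_class_less) (auto simp: add.commute)
      moreover have "4 * s + 6 < 2 * r" using 6 assms(2) s by simp
      moreover have "k (4 * s + 6) = 2 * q + 1" using 6 assms(2) s by (simp add: k_def)
      ultimately show ?thesis using 6 by simp
    next
      case 7
      then have "p t = 4 * s + 7" "p (Suc t) = 1"
        using assms(2) s by (simp_all add: p_def)
      moreover have "walecki_class r (4 * s + 7) 1 = (2 * s + 4 + 2 * r) mod (2 * r)"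
        using 7 assms(2) s by (subst walecki_class_greater) (auto simp: add.commute mod_if)
      moreover have "2 * s + 4 < 2 * r" using 7 assms(2) s by simp
      moreover have "k (2 * s + 4) = 2 * q + 2" using 7 assms(2) s by (simp add: k_def)
      ultimately show ?thesis using 7 by (simp only: mod_add_self2 mod_less simp_thms)
    next
      case 8
      then have "p t = 2 * u + 1" "p (Suc t) = 2 * u + 3"
        using assms(2) s by (simp_all add: p_def)
      moreover have "walecki_class r (2 * u + 1) (2 * u + 3) = (2 * (u + 1 + q)) mod (2 * r)"
        using 8 assms(2) s by (subst walecki_class_less) (auto simp: add.commute)
      moreover have "2 * (u + 1 + q) < 2 * r" using 8 assms(2) s by simp
      moreover have "k (2 * (u + 1 + q)) = 2 * q + 3 + u" using 8 assms(2) s by (simp add: k_def)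
      ultimately show ?thesis using 8 by simp
    next
      case 9
      then have "p t = 2 * s + 1" "p (Suc t) = 2 * s + 5"
        using assms(2) s by (simp_all add: p_def)
      moreover have "walecki_class r (2 * s + 1) (2 * s + 5) = (4 * s + 7) mod (2 * r)"
        using 9 assms(2) s by (subst walecki_class_less) (auto simp: add.commute)
      moreover have "4 * s + 7 < 2 * r" using 9 assms(2) s by simp
      moreover have "k (4 * s + 7) = 3 * q + 1" using 9 assms(2) s by (simp add: k_def)
      ultimately show ?thesis using 9 by simp
    next
      case 10
      then have "p t = 2 * (q + u) + 1" "p (Suc t) = 2 * (q + u) + 3"
        using assms(2) s by (simp_all add: p_def)
      moreover have "walecki_class r (2 * (q + u) + 1) (2 * (q + u) + 3) = (2 * (u + 1) + 2 * r) mod (2 * r)"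
        using 10 assms(2) s by (subst walecki_class_less) (auto simp: add.commute)
      moreover have "2 * (u + 1) < 2 * r" using 10 assms(2) s by simp
      moreover have "k (2 * (u + 1)) = 3 * q + 2 + u" using 10 assms(2) s by (simp add: k_def)
      ultimately show ?thesis using 10 by (simp only: mod_add_self2 mod_less simp_thms)
    qed
  qed
  ultimately show ?thesis by blast
qed

text \<open>The bound on \<open>r\<close> is sharp: by \<open>arc_split_insert\<close> such a path
  for r = 1 or r = 2 would decompose the complete digraph on 4 or 6 vertices, which is
  impossible.\<close>

lemma rainbow_path:
  assumes "3 \<le> r"
  obtains p where "inj_on p {..2 * r}" "p ` {..2 * r} = {..2 * r}"
    and "inj_on (\<lambda>t. walecki_class r (p t) (p (Suc t))) {..<2 * r}"
    and "\<And>t. t < 2 * r \<Longrightarrow> walecki_class r (p t) (p (Suc t)) < 2 * r"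
proof -
  have "\<exists>p h k. (\<forall>t\<le>2 * r. p t \<le> 2 * r \<and> h (p t) = t) \<and>
    (\<forall>t<2 * r. walecki_class r (p t) (p (Suc t)) < 2 * r \<and> k (walecki_class r (p t) (p (Suc t))) = t)"
  proof (cases "even r")
    case True
    then obtain q where "r = 2 * q" by (elim evenE)
    then show ?thesis using rainbow_path_even[of q r] assms by simp
  next
    case False
    then obtain q where "r = 2 * q + 1" by (elim oddE)
    then show ?thesis using rainbow_path_odd[of q r] assms by simp
  qed
  then obtain p h k where p: "\<And>t. t \<le> 2 * r \<Longrightarrow> p t \<le> 2 * r" "\<And>t. t \<le> 2 * r \<Longrightarrow> h (p t) = t"
    and c: "\<And>t. t < 2 * r \<Longrightarrow> walecki_class r (p t) (p (Suc t)) < 2 * r"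
      "\<And>t. t < 2 * r \<Longrightarrow> k (walecki_class r (p t) (p (Suc t))) = t" by blast
  have inj: "inj_on p {..2 * r}" using p(2) by (intro inj_on_inverseI[where g = h]) simp
  moreover have "p ` {..2 * r} = {..2 * r}" using p(1) inj by (intro endo_inj_surj) auto
  moreover have "inj_on (\<lambda>t. walecki_class r (p t) (p (Suc t))) {..<2 * r}"
    using c(2) by (intro inj_on_inverseI[where g = k]) simp
  ultimately show ?thesis using that c(1) by blast
qed

section \<open>Hamiltonian decompositions of complete digraphs\<close>

text \<open>The sufficiency half of Tillson's theorem. Odd orders use Walecki's cycles, order 2 is a
  single 2-cycle, and even orders from 8 on arise by inserting one vertex along a rainbow path. All
  are built on natural numbers and then transferred to \<open>S\<close>.\<close>

lemma arc_split_complete: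
  assumes "finite S" "2 \<le> card S" "card S \<notin> {4, 6}"
  shows "\<exists>F. arc_split S (card S - 1) F"
proof -
  have "\<exists>(T :: nat set) F. finite T \<and> card T = card S \<and> arc_split T (card S - 1) F"
  proof (cases "even (card S)")
    case False
    then obtain r where "card S = 2 * r + 1" by (elim oddE)
    then show ?thesis using arc_split_walecki[of r]
      by (intro exI[of _ "{..2 * r}"] exI[of _ "walecki_cycle r"]) simp
  next
    case True
    show ?thesis
    proof (cases "card S = 2")
      case True
      have "strong {0, 1} {(0, 1), (1, 0 :: nat)}" by (auto simp: strong_def)
      then have "arc_split {0, 1 :: nat} 1 (\<lambda>_. {(0, 1), (1, 0)})"
        by (auto simp: arc_split_def)
      then show ?thesis using True
        by (intro exI[of _ "{0, 1}"] exI[of _ "\<lambda>_. {(0, 1), (1, 0)}"]) simp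
    next
      case False
      from True obtain s where "card S = 2 * s" by (elim evenE)
      with False assms obtain r where r: "card S = 2 * r + 2" "3 \<le> r"
        by (intro that[of "s - 1"]) auto
      from rainbow_path[OF r(2)] obtain p where
        p: "inj_on p {..2 * r}" "p ` {..2 * r} = {..2 * r}"
          "inj_on (\<lambda>t. walecki_class r (p t) (p (Suc t))) {..<2 * r}"
          "\<And>t. t < 2 * r \<Longrightarrow> walecki_class r (p t) (p (Suc t)) < 2 * r" by blast
      have "(p t, p (Suc t)) \<in> walecki_cycle r (walecki_class r (p t) (p (Suc t)))"
        if "t < 2 * r" for t
      proof -
        have "p t \<in> {..2 * r}" "p (Suc t) \<in> {..2 * r}" using p(2) that by auto
        moreover have "p t \<noteq> p (Suc t)" using inj_onD[OF p(1), of t "Suc t"] that by auto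
        ultimately show ?thesis by (simp add: walecki_cycle_def)
      qed
      then obtain G where "arc_split (insert (2 * r + 1) {..2 * r}) (Suc (2 * r)) G"
        using arc_split_insert[OF arc_split_walecki _ p(1,2,3), of "2 * r + 1"] p(4) by auto
      then show ?thesis using r
        by (intro exI[of _ "insert (2 * r + 1) {..2 * r}"] exI[of _ G]) simp
    qed
  qed
  then obtain T :: "nat set" and F where T: "finite T" "card T = card S" "arc_split T (card S - 1) F"
    by blast
  then obtain f where "bij_betw f T S" using finite_same_card_bij assms(1) by blast
  then show ?thesis using arc_split_transfer T(3) by blast
qed

section \<open>The exceptional orders 4 and 6\<close>

lemma strong_out_arc:
  assumes "strong S F" "s \<in> S" "t \<in> S" "s \<noteq> t"
  shows "\<exists>y. (s, y) \<in> F"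
  using assms unfolding strong_def by (metis converse_rtranclE)

text \<open>Rotation pairs the last vertex with the first, which supplies the closing arc. Lists
  rather than sets keep the later search executable.\<close>

definition cycle_arcs :: "'a list \<Rightarrow> ('a \<times> 'a) list" where
  "cycle_arcs xs = zip xs (rotate1 xs)"

text \<open>\<open>F\<close> is the graph of a map \<open>f\<close> on \<open>S\<close>. Strongness
  makes the orbit of \<open>v\<close> cover \<open>S\<close>, so its first \<open>card S\<close>
  points are distinct; it also makes \<open>f\<close> a permutation, so the orbit closes up at
  \<open>v\<close> itself.\<close>

lemma strong_functional_imp_cycle:
  assumes "finite S" "2 \<le> card S" "F \<subseteq> S \<times> S" "strong S F" "single_valued F" "v \<in> S"
  obtains xs where "xs \<noteq> []" "hd xs = v" "distinct xs" "set xs = S" "set (cycle_arcs xs) \<subseteq> F"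
proof -
  define f where "f x = (SOME y. (x, y) \<in> F)" for x
  have ex: "\<exists>y. (x, y) \<in> F" if x: "x \<in> S" for x
  proof -
    have "S \<noteq> {x}" using assms(2) by auto
    then obtain t where "t \<in> S" "x \<noteq> t" using x by auto
    then show ?thesis using strong_out_arc[OF assms(4) x] by blast
  qed
  have f: "(x, f x) \<in> F" if "x \<in> S" for x
    unfolding f_def using ex[OF that] by (rule someI_ex)
  have fS: "f x \<in> S" if "x \<in> S" for x using f[OF that] assms(3) by auto
  have reach: "\<exists>i. y = (f ^^ i) x" if "(x, y) \<in> F\<^sup>*" for x y
    using that
  proof induction
    case base
    show ?case by (rule exI[of _ 0]) simp
  next
    case (step y z)
    then obtain i where "y = (f ^^ i) x" by blast
    moreover have "z = f y" using step(2) f[of y] assms(3,5) by (auto dest: single_valuedD)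
    ultimately show ?case by (intro exI[of _ "Suc i"]) simp
  qed
  let ?z = "\<lambda>i. (f ^^ i) v" and ?k = "card S"
  have zS: "?z i \<in> S" for i by (induction i) (use assms(6) fS in auto)
  have cov: "\<exists>i. u = ?z i" if "u \<in> S" for u
    using reach assms(4,6) that by (auto simp: strong_def)
  have inj: "inj_on ?z {..<?k}"
  proof (rule linorder_inj_onI)
    fix i j assume ij: "i < j" "i \<in> {..<?k}" "j \<in> {..<?k}"
    show "?z i \<noteq> ?z j"
    proof
      assume eq: "?z i = ?z j"
      \<comment> \<open>A repetition at time \<open>j < card S\<close> would trap the whole orbit in
        its first \<open>j\<close> points, too few to cover \<open>S\<close>.\<close>
      have "?z n \<in> ?z ` {..<j}" for n
      proof (induction n)
        case 0
        have "?z 0 = v" by simp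
        then show ?case using ij by (intro image_eqI[of _ _ 0]) auto
      next
        case (Suc n)
        then obtain l where l: "l < j" "?z n = ?z l" by auto
        then have n: "?z (Suc n) = ?z (Suc l)" by simp
        show ?case
        proof (cases "Suc l = j")
          case True
          then show ?thesis using n eq ij by (metis imageI lessThan_iff)
        next
          case False
          then show ?thesis using n l by (metis Suc_lessI imageI lessThan_iff)
        qed
      qed
      then have "S \<subseteq> ?z ` {..<j}" using cov by blast
      then have "?k \<le> card (?z ` {..<j})" by (intro card_mono) auto
      also have "\<dots> \<le> j" using card_image_le[of "{..<j}" ?z] by simp
      finally show False using ij by simp
    qed
  qed auto
  have img: "?z ` {..<?k} = S"
    using zS card_image[OF inj] by (intro card_subset_eq assms(1)) auto
  \<comment> \<open>A walk from \<open>f u\<close> back to \<open>u\<close> exhibits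
    \<open>u\<close> as a value of \<open>f\<close>; on a finite set surjectivity gives
    injectivity.\<close>
  have "S \<subseteq> f ` S"
  proof
    fix u assume u: "u \<in> S"
    then have "(f u, u) \<in> F\<^sup>*" using fS assms(4) by (auto simp: strong_def)
    then obtain i where "u = (f ^^ i) (f u)" using reach by blast
    then have "u = f ((f ^^ i) u)" by (simp add: funpow_swap1)
    moreover have "(f ^^ i) u \<in> S" by (induction i) (use u fS in auto)
    ultimately show "u \<in> f ` S" by blast
  qed
  then have injf: "inj_on f S" using assms(1) by (rule finite_surj_inj[rotated])
  have "?z ?k = v"
  proof -
    have "?z ?k \<in> ?z ` {..<?k}" unfolding img by (rule zS)
    then obtain j where j: "j < ?k" "?z ?k = ?z j" by (elim imageE) (simp only: lessThan_iff)
    show ?thesis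
    proof (cases j)
      case 0
      then show ?thesis using j by simp
    next
      case (Suc l)
      obtain k' where k': "?k = Suc k'" using assms(2) by (cases ?k) auto
      \<comment> \<open>Cancelling \<open>f\<close> moves the collision among the first
        \<open>card S\<close> iterates, which are distinct. This forces \<open>j = card S\<close>, a
        contradiction, so only \<open>j = 0\<close> remains.\<close>
      then have "f (?z k') = f (?z l)" using j Suc by simp
      then have "?z k' = ?z l" using injf zS by (meson inj_onD)
      then have "k' = l" using inj_onD[OF inj, of k' l] k' j Suc by auto
      then show ?thesis using j k' Suc by simp
    qed
  qed
  then have last: "?z (Suc i mod ?k) = ?z (Suc i)" if "i < ?k" for i
    using that by (cases "Suc i = ?k") auto
  define xs where "xs = map ?z [0..<?k]"
  have rot: "rotate1 xs = map (\<lambda>i. f (?z i)) [0..<?k]"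
    by (rule nth_equalityI) (use last in \<open>simp_all add: xs_def nth_rotate1\<close>)
  show ?thesis
  proof (rule that[of xs])
    show "xs \<noteq> []" using assms(2) by (simp add: xs_def)
    show "hd xs = v" using assms(2) by (simp add: xs_def hd_map)
    show "distinct xs" using inj by (simp add: xs_def distinct_map atLeast0LessThan)
    show "set xs = S" using img by (simp add: xs_def atLeast0LessThan)
    show "set (cycle_arcs xs) \<subseteq> F"
      unfolding cycle_arcs_def rot unfolding xs_def using f zS by (auto simp: zip_map_map zip_same_conv_map)
  qed
qed

section \<open>Exhaustive search for arc-disjoint Hamiltonian cycles\<close>

primrec arrangements :: "nat \<Rightarrow> 'a list \<Rightarrow> 'a list list" where
  "arrangements 0 xs = [[]]"
| "arrangements (Suc n) xs = concat (map (\<lambda>x. map ((#) x) (arrangements n (remove1 x xs))) xs)"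

lemma arrangements_complete:
  "distinct ys \<Longrightarrow> set ys \<subseteq> set xs \<Longrightarrow> length ys = n \<Longrightarrow> ys \<in> set (arrangements n xs)"
proof (induction n arbitrary: xs ys)
  case (Suc n)
  obtain y zs where ys: "ys = y # zs" using Suc.prems(3) by (auto simp: length_Suc_conv)
  have "x \<in> set (remove1 y xs)" if "x \<in> set zs" for x
  proof -
    have "x \<noteq> y" "x \<in> set xs" using that Suc.prems ys by auto
    then show ?thesis by (simp add: in_set_remove1)
  qed
  then have "zs \<in> set (arrangements n (remove1 y xs))"
    using Suc.prems ys by (intro Suc.IH) auto
  then show ?case using Suc.prems ys by auto
qed simp

definition apart :: "'a list \<Rightarrow> 'a list \<Rightarrow> bool" where
  "apart xs ys \<longleftrightarrow> list_all (\<lambda>x. x \<notin> set ys) xs"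

lemma apart_iff: "apart xs ys \<longleftrightarrow> set xs \<inter> set ys = {}"
  by (auto simp: apart_def list_all_iff)

primrec packable :: "nat \<Rightarrow> 'a list list \<Rightarrow> bool" where
  "packable 0 C = True"
| "packable (Suc m) C = list_ex (\<lambda>a. packable m (filter (apart a) C)) C"

text \<open>Choosing \<open>G m\<close> first leaves all other members in the filtered pool, so the
  search finds every pairwise disjoint selection.\<close>

lemma packableI:
  assumes "\<And>i. i < m \<Longrightarrow> G i \<in> set C" "\<And>i j. i < m \<Longrightarrow> j < m \<Longrightarrow> i \<noteq> j \<Longrightarrow> apart (G i) (G j)"
  shows "packable m C"
  using assms
proof (induction m arbitrary: C)
  case (Suc m)
  have "packable m (filter (apart (G m)) C)"
    using Suc.prems by (intro Suc.IH) auto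
  then show ?case using Suc.prems(1)[of m] by (auto simp: list_ex_iff)
qed simp

text \<open>The possible further cycles once the vertices are numbered along the first one.\<close>
definition cycle_candidates :: "nat \<Rightarrow> (nat \<times> nat) list list" where
  "cycle_candidates k = filter (apart (cycle_arcs [0..<k]))
     (map (\<lambda>p. cycle_arcs (0 # p)) (arrangements (k - 1) [1..<k]))"

text \<open>Once the first cycle is fixed, a decomposition of order k would need k - 2 further
  cycles: two here and four for order 6.\<close>

lemma not_packable_4: "\<not> packable 2 (cycle_candidates 4)"
  by code_simp

lemma not_packable_6: "\<not> packable 4 (cycle_candidates 6)"
  by code_simp

lemma cycle_arcs_map: "cycle_arcs (map f xs) = map (map_prod f f) (cycle_arcs xs)"
  by (simp add: cycle_arcs_def rotate1_map zip_map_map map_prod_def)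

lemma set_cycle_arcs_subset: "set (cycle_arcs xs) \<subseteq> set xs \<times> set xs"
  by (auto simp: cycle_arcs_def dest: set_zip_leftD set_zip_rightD)

text \<open>All members are Hamiltonian cycles. Numbering \<open>S\<close> along the first of them
  turns the others into pairwise disjoint elements of \<open>cycle_candidates k\<close>, against the
  search.\<close>

lemma no_functional_arc_split:
  assumes F: "arc_split S (k - 1) F" and S: "finite S" "card S = k" "k \<in> {4, 6}"
    and sv: "\<And>i. i < k - 1 \<Longrightarrow> single_valued (F i)"
  shows False
proof -
  have k: "2 \<le> k" "0 < k - 1" "\<And>i. i < k - 2 \<Longrightarrow> Suc i < k - 1" using S(3) by auto
  obtain v where v: "v \<in> S" using S by fastforce
  have "\<exists>xs. xs \<noteq> [] \<and> hd xs = v \<and> distinct xs \<and> set xs = S \<and> set (cycle_arcs xs) \<subseteq> F i"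
    if "i < k - 1" for i
  proof -
    have "F i \<subseteq> S \<times> S" using arc_splitD(1)[OF F that] by auto
    from strong_functional_imp_cycle[OF S(1) _ this arc_splitD(2)[OF F that] sv[OF that] v]
    show ?thesis using S(2) k by metis
  qed
  then obtain X where X: "\<And>i. i < k - 1 \<Longrightarrow> X i \<noteq> []" "\<And>i. i < k - 1 \<Longrightarrow> hd (X i) = v"
      "\<And>i. i < k - 1 \<Longrightarrow> distinct (X i)" "\<And>i. i < k - 1 \<Longrightarrow> set (X i) = S"
      "\<And>i. i < k - 1 \<Longrightarrow> set (cycle_arcs (X i)) \<subseteq> F i"
    by metis
  have len: "length (X i) = k" if "i < k - 1" for i
    using distinct_card[OF X(3)[OF that]] X(4)[OF that] S(2) by simp
  \<comment> \<open>\<open>f\<close> sends a vertex to its position on the first cycle.\<close>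
  define f where "f = inv_into {..<k} ((!) (X 0))"
  have bij: "bij_betw ((!) (X 0)) {..<k} S"
    using bij_betw_nth[OF X(3)[OF k(2)]] len[OF k(2)] X(4)[OF k(2)] by auto
  then have f: "bij_betw f S {..<k}" unfolding f_def by (rule bij_betw_inv_into)
  then have injf: "inj_on f S" by (simp add: bij_betw_def)
  have "f (X 0 ! i) = i" if "i < k" for i
    unfolding f_def using bij that by (simp add: bij_betw_def inv_into_f_f)
  then have X0: "map f (X 0) = [0..<k]"
    using len[OF k(2)] by (intro nth_equalityI) simp_all
  \<comment> \<open>All cycles were listed from the same vertex \<open>v\<close>, so after
    renumbering each starts with 0, as the candidates do.\<close>
  have fv: "f v = 0" using X0 X(1,2)[OF k(2)] k(1) hd_map[of "X 0" f] by simp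
  define G where "G i = cycle_arcs (map f (X i))" for i
  have apart: "apart (G i) (G j)" if "i < k - 1" "j < k - 1" "i \<noteq> j" for i j
  proof -
    have "set (cycle_arcs (X i)) \<inter> set (cycle_arcs (X j)) = {}"
      using X(5) that arc_splitD(3)[OF F] by blast
    moreover have "inj_on (map_prod f f) (S \<times> S)" using injf by (auto simp: inj_on_def)
    moreover have "set (cycle_arcs (X l)) \<subseteq> S \<times> S" if "l < k - 1" for l
      using set_cycle_arcs_subset X(4)[OF that] by blast
    ultimately have "map_prod f f ` set (cycle_arcs (X i)) \<inter> map_prod f f ` set (cycle_arcs (X j)) = {}"
      using that inj_on_image_Int[of "map_prod f f" "S \<times> S"] by (metis image_empty)
    then show ?thesis by (simp add: G_def apart_iff cycle_arcs_map)
  qed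
  have "packable (k - 2) (cycle_candidates k)"
  proof (rule packableI[where G = "\<lambda>i. G (Suc i)"])
    fix i assume "i < k - 2"
    then have i: "Suc i < k - 1" by (rule k(3))
    obtain ys where ys: "X (Suc i) = v # ys" using X(1,2)[OF i] by (cases "X (Suc i)") auto
    have "distinct (map f (X (Suc i)))" "set (map f (X (Suc i))) = {..<k}"
      using X(3,4)[OF i] f by (simp_all add: bij_betw_def distinct_map)
    then have d: "distinct (map f ys)" "0 \<notin> set (map f ys)" "set (map f ys) \<subseteq> {..<k}"
      using ys fv by auto
    have "x \<in> {1..<k}" if "x \<in> set (map f ys)" for x
      using d(2,3) that by (cases x) auto
    then have "map f ys \<in> set (arrangements (k - 1) [1..<k])"
      using d(1) len[OF i] ys by (intro arrangements_complete) auto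
    moreover have "apart (cycle_arcs [0..<k]) (cycle_arcs (0 # map f ys))"
      using apart[OF k(2) i] ys fv X0 by (simp add: G_def)
    ultimately show "G (Suc i) \<in> set (cycle_candidates k)"
      using ys fv by (simp add: G_def cycle_candidates_def)
  qed (use apart k(3) in auto)
  then show False using S(3) not_packable_4 not_packable_6 by auto
qed

section \<open>Internally disjoint strong subgraphs\<close>

lemma family_disjoint:
  assumes "S_internally_disjoint_family V A S p Ds" "i < p" "j < p" "i \<noteq> j"
  shows "fst (Ds i) \<inter> fst (Ds j) = S" "snd (Ds i) \<inter> snd (Ds j) = {}"
proof -
  have *: "fst (Ds i) \<inter> fst (Ds j) = S \<and> snd (Ds i) \<inter> snd (Ds j) = {}"
    if "i < p" "j < p" "i < j" for i j
    using assms(1) that by (simp add: S_internally_disjoint_family_def)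
  show "fst (Ds i) \<inter> fst (Ds j) = S" "snd (Ds i) \<inter> snd (Ds j) = {}"
    using *[of i j] *[of j i] assms(2-4) by (metis Int_commute nat_neq_iff)+
qed

context
  fixes V :: "'a set" and A S p Ds s
  assumes D: "digraph V A" and fam: "S_internally_disjoint_family V A S p Ds"
    and S: "s \<in> S" "2 \<le> card S"
begin

lemma family_out_degree_ge:
  assumes "i < p"
  shows "1 \<le> card (snd (Ds i) `` {s})"
proof -
  have i: "subdigraph (fst (Ds i)) (snd (Ds i)) V A" "strong (fst (Ds i)) (snd (Ds i))" "S \<subseteq> fst (Ds i)"
    using fam assms by (auto simp: S_internally_disjoint_family_def)
  have "S \<noteq> {s}" using S(2) by auto
  then obtain t where "t \<in> S" "s \<noteq> t" using S(1) by auto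
  then have "snd (Ds i) `` {s} \<noteq> {}" using strong_out_arc[OF i(2)] i(3) S(1) by blast
  moreover have "snd (Ds i) `` {s} \<subseteq> V" using i(1) unfolding subdigraph_def by blast
  then have "finite (snd (Ds i) `` {s})"
    using D finite_subset unfolding digraph_def by blast
  ultimately show ?thesis by (simp add: Suc_le_eq card_gt_0_iff)
qed

text \<open>Arc-disjoint members have disjoint out-neighbourhoods at \<open>s\<close>.\<close>

lemma family_out_degree_sum: "(\<Sum>i<p. card (snd (Ds i) `` {s})) \<le> card (A `` {s})"
proof -
  have "A `` {s} \<subseteq> V" "finite V" using D unfolding digraph_def by blast+
  then have fin: "finite (A `` {s})" by (rule finite_subset)
  have sub: "snd (Ds i) `` {s} \<subseteq> A `` {s}" if "i < p" for i
    using fam that by (auto simp: S_internally_disjoint_family_def subdigraph_def)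
  have "(\<Sum>i<p. card (snd (Ds i) `` {s})) = card (\<Union>i<p. snd (Ds i) `` {s})"
    using finite_subset[OF sub fin] family_disjoint(2)[OF fam]
    by (intro card_UN_disjoint[symmetric]) blast+
  also have "\<dots> \<le> card (A `` {s})" using sub by (intro card_mono fin) blast
  finally show ?thesis .
qed

lemma family_size_le: "p \<le> card (A `` {s})"
proof -
  have "p = (\<Sum>i<p. 1)" by simp
  also have "\<dots> \<le> (\<Sum>i<p. card (snd (Ds i) `` {s}))" using family_out_degree_ge by (intro sum_mono) simp
  finally show ?thesis using family_out_degree_sum by simp
qed

text \<open>Each of the \<open>p\<close> members takes at least one arc out of \<open>s\<close>; a
  second arc in any of them would exceed the supply.\<close>

lemma family_out_degree_one:
  assumes "card (A `` {s}) \<le> p" "i < p"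
  shows "card (snd (Ds i) `` {s}) = 1"
proof (rule ccontr)
  assume "card (snd (Ds i) `` {s}) \<noteq> 1"
  then have "1 < card (snd (Ds i) `` {s})" using family_out_degree_ge[OF assms(2)] by simp
  then have "(\<Sum>i<p. 1) < (\<Sum>i<p. card (snd (Ds i) `` {s}))"
    using family_out_degree_ge assms(2) by (intro sum_strict_mono_ex1) auto
  then show False using family_out_degree_sum assms(1) by simp
qed

end

section \<open>Bounds for \<open>kappa_S\<close> and \<open>kappa_k\<close>\<close>

lemma out_degree_le:
  assumes "digraph V A" "s \<in> V"
  shows "card (A `` {s}) \<le> card V - 1"
proof -
  have "card (A `` {s}) \<le> card (V - {s})"
    using assms by (intro card_mono) (auto simp: digraph_def)
  then show ?thesis using assms by (simp add: digraph_def)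
qed

lemma out_degree_eqD:
  assumes "digraph V A" "s \<in> V" "card V - 1 \<le> card (A `` {s})"
  shows "A `` {s} = V - {s}"
  using assms by (intro card_seteq) (auto simp: digraph_def)

context
  fixes V :: "'a set" and A S
  assumes D: "digraph V A" and S: "S \<subseteq> V" "2 \<le> card S"
begin

lemma family_size_less_card:
  assumes "S_internally_disjoint_family V A S p Ds"
  shows "p \<le> card V - 1"
proof -
  obtain s where s: "s \<in> S" using S(2) by fastforce
  show ?thesis using family_size_le[OF D assms s S(2)] out_degree_le[OF D, of s] s S(1) by auto
qed

text \<open>The out-degree bound on family sizes is what makes the \<open>GREATEST\<close> in
  \<open>kappa_S\<close> meaningful; the empty family provides the starting value 0 in the next
  lemma.\<close>

lemma kappa_S_ge:
  assumes "S_internally_disjoint_family V A S p Ds"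
  shows "p \<le> kappa_S V A S"
  unfolding kappa_S_def using assms family_size_less_card by (intro Greatest_le_nat) blast+

lemma kappa_S_attained: "\<exists>Ds. S_internally_disjoint_family V A S (kappa_S V A S) Ds"
  unfolding kappa_S_def
proof (rule GreatestI_nat)
  show "\<exists>Ds. S_internally_disjoint_family V A S 0 Ds"
    by (simp add: S_internally_disjoint_family_def)
qed (use family_size_less_card in blast)

lemma kappa_S_le_out_degree: "s \<in> S \<Longrightarrow> kappa_S V A S \<le> card (A `` {s})"
  using kappa_S_attained family_size_le[OF D _ _ S(2)] by blast

lemma kappa_S_le: "kappa_S V A S \<le> card V - 1"
  using kappa_S_attained family_size_less_card by blast

lemma kappa_S_pos: "strong V A \<Longrightarrow> 1 \<le> kappa_S V A S"
  using D S by (intro kappa_S_ge[where Ds = "\<lambda>_. (V, A)"])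
    (auto simp: S_internally_disjoint_family_def subdigraph_def digraph_def)

end

context
  fixes V :: "'a set" and A k
  assumes D: "digraph V A" and k: "2 \<le> k" "k \<le> card V"
begin

lemma finite_vertices: "finite V"
  using D by (simp add: digraph_def)

lemma kappa_k_attained: "\<exists>S. S \<subseteq> V \<and> card S = k \<and> kappa_k V A k = kappa_S V A S"
proof -
  have "finite {kappa_S V A S |S. S \<subseteq> V \<and> card S = k}" using finite_vertices by simp
  moreover obtain S where "S \<subseteq> V" "card S = k" using obtain_subset_with_card_n[OF k(2)] by blast
  ultimately have "kappa_k V A k \<in> {kappa_S V A S |S. S \<subseteq> V \<and> card S = k}"
    unfolding kappa_k_def by (intro Min_in) auto
  then show ?thesis by auto
qed

lemma kappa_k_le_kappa_S: "S \<subseteq> V \<Longrightarrow> card S = k \<Longrightarrow> kappa_k V A k \<le> kappa_S V A S"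
  unfolding kappa_k_def using finite_vertices by (intro Min_le) auto

lemma kappa_k_pos: "strong V A \<Longrightarrow> 1 \<le> kappa_k V A k"
  using kappa_k_attained kappa_S_pos[OF D] k(1) by metis

lemma kappa_k_le: "kappa_k V A k \<le> card V - 1"
  using kappa_k_attained kappa_S_le[OF D] k(1) by metis

text \<open>Any vertex \<open>s\<close> extends to a \<open>k\<close>-subset of \<open>V\<close>,
  and the bound for that subset passes to the minimum.\<close>

lemma kappa_k_le_out_degree:
  assumes "s \<in> V"
  shows "kappa_k V A k \<le> card (A `` {s})"
proof -
  have "k - 1 \<le> card (V - {s})" using assms k finite_vertices by simp
  then obtain T where T: "T \<subseteq> V - {s}" "card T = k - 1" "finite T"
    using obtain_subset_with_card_n by metis
  then have "insert s T \<subseteq> V" "card (insert s T) = k" using assms k(1) by (auto simp: card_insert_if)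
  then show ?thesis
    using kappa_k_le_kappa_S[of "insert s T"] kappa_S_le_out_degree[OF D, of "insert s T" s] k(1)
    by auto
qed

lemma arcs_complete_if_kappa_k_max:
  assumes "kappa_k V A k = card V - 1"
  shows "A = V \<times> V - Id"
proof -
  have "A `` {s} = V - {s}" if "s \<in> V" for s
    using out_degree_eqD[OF D that] kappa_k_le_out_degree[OF that] assms by simp
  then show ?thesis using D by (auto simp: digraph_def)
qed

text \<open>In a family of n - 1 subgraphs every vertex of S has out-degree 1 in each member, and at most
  n - k members can own a vertex outside S; the others are Hamiltonian cycles of S.\<close>
lemma exceptional_kappa_k:
  assumes "k \<in> {4, 6}"
  shows "kappa_k V A k \<noteq> card V - 1"
proof
  assume max: "kappa_k V A k = card V - 1"
  obtain S where S: "S \<subseteq> V" "card S = k" using obtain_subset_with_card_n[OF k(2)] by blast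
  have finS: "finite S" using S finite_vertices by (auto intro: finite_subset)
  let ?p = "card V - 1"
  have "kappa_S V A S = ?p"
    using kappa_k_le_kappa_S[OF S] kappa_S_le[OF D S(1)] S(2) k(1) max by simp
  then obtain Ds where fam: "S_internally_disjoint_family V A S ?p Ds"
    using kappa_S_attained[OF D S(1)] S(2) k(1) by auto
  have Ds: "fst (Ds i) \<subseteq> V" "snd (Ds i) \<subseteq> A" "snd (Ds i) \<subseteq> fst (Ds i) \<times> fst (Ds i)"
      "strong (fst (Ds i)) (snd (Ds i))" "S \<subseteq> fst (Ds i)" if "i < ?p" for i
    using fam that by (auto simp: S_internally_disjoint_family_def subdigraph_def)
  note dis = family_disjoint[OF fam]
  define X where "X = {i. i < ?p \<and> fst (Ds i) \<noteq> S}"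
  define I where "I = {i. i < ?p \<and> fst (Ds i) = S}"
  have fin: "finite X" "finite I" by (simp_all add: X_def I_def)
  have "\<forall>i\<in>X. \<exists>v. v \<in> fst (Ds i) - S" using Ds(5) by (fastforce simp: X_def)
  \<comment> \<open>Each member larger than \<open>S\<close> gets a vertex of its own outside
    \<open>S\<close>; members meet only in \<open>S\<close>, so these vertices are distinct.\<close>
  then obtain w where w: "\<And>i. i \<in> X \<Longrightarrow> w i \<in> fst (Ds i) - S" by metis
  have "inj_on w X"
  proof (rule inj_onI, rule ccontr)
    fix i j assume ij: "i \<in> X" "j \<in> X" "w i = w j" "i \<noteq> j"
    then show False using w[of i] w[of j] dis(1)[of i j] by (auto simp: X_def)
  qed
  moreover have "w ` X \<subseteq> V - S" using w Ds(1) by (fastforce simp: X_def)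
  ultimately have "card X \<le> card (V - S)" using finite_vertices by (intro card_inj_on_le[of w]) auto
  also have "\<dots> = card V - k" using S finS by (simp add: card_Diff_subset)
  finally have "card X \<le> card V - k" .
  moreover have "card X + card I = ?p"
  proof -
    have "X \<union> I = {..<?p}" "X \<inter> I = {}" by (auto simp: X_def I_def)
    then show ?thesis using card_Un_disjoint[OF fin] by simp
  qed
  ultimately have "k - 1 \<le> card I" using k by simp
  then obtain J where J: "J \<subseteq> I" "card J = k - 1" "finite J" using obtain_subset_with_card_n by metis
  \<comment> \<open>Exactly \<open>k - 1\<close> of the members spanning \<open>S\<close> are kept
    and renumbered from 0, to match the shape of \<open>arc_split\<close>.\<close>
  then obtain e where "bij_betw e {0..<k - 1} J" using ex_bij_betw_nat_finite by metis
  then have e: "inj_on e {..<k - 1}" "e ` {..<k - 1} = J" by (auto simp: bij_betw_def atLeast0LessThan)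
  have eI: "e i < ?p" "fst (Ds (e i)) = S" if "i < k - 1" for i
    using e(2) J(1) that by (auto simp: I_def)
  define F where "F i = snd (Ds (e i))" for i
  show False
  proof (rule no_functional_arc_split[OF _ finS S(2) assms])
    have "F i \<subseteq> S \<times> S - Id" if "i < k - 1" for i
      using Ds(2,3)[OF eI(1)[OF that]] eI(2)[OF that] D by (auto simp: F_def digraph_def)
    moreover have "strong S (F i)" if "i < k - 1" for i
      using Ds(4)[OF eI(1)[OF that]] eI(2)[OF that] by (simp add: F_def)
    moreover have "F i \<inter> F j = {}" if "i < k - 1" "j < k - 1" "i \<noteq> j" for i j
      using inj_onD[OF e(1), of i j] that unfolding F_def by (intro dis(2) eI(1)) auto
    ultimately show "arc_split S (k - 1) F" by (simp add: arc_split_def)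
    fix i assume i: "i < k - 1"
    show "single_valued (F i)"
    proof (rule single_valuedI)
      fix x y z assume xy: "(x, y) \<in> F i" "(x, z) \<in> F i"
      then have x: "x \<in> S" using Ds(3)[OF eI(1)[OF i]] eI(2)[OF i] by (auto simp: F_def)
      \<comment> \<open>With n - 1 members the out-degree count at \<open>x\<close> is tight, so
        every member is functional on \<open>S\<close>.\<close>
      have "card (A `` {x}) \<le> ?p" using out_degree_le[OF D] x S(1) by auto
      then have "card (F i `` {x}) = 1" unfolding F_def
        using S(2) k(1) by (intro family_out_degree_one[OF D fam x _ _ eI(1)[OF i]]) auto
      moreover have "y \<in> F i `` {x}" "z \<in> F i `` {x}" using xy by auto
      ultimately show "y = z" by (metis card_1_singletonE singletonD)
    qed
  qed
qed

end

section \<open>Extremal digraphs\<close>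

text \<open>The members \<open>F i\<close> use arcs inside \<open>S\<close>, while every arc of a
  star has one end at its own outer vertex; hence all are disjoint. For
  \<open>m = card S - 1\<close> the size is \<open>card V - 1\<close>.\<close>

lemma complete_family:
  assumes "finite V" "S \<subseteq> V" and F: "arc_split S m F"
  shows "\<exists>Ds. S_internally_disjoint_family V (V \<times> V - Id) S (m + card (V - S)) Ds"
proof -
  obtain h where h: "bij_betw h {0..<card (V - S)} (V - S)"
    using ex_bij_betw_nat_finite[of "V - S"] assms(1) by auto
  define u where "u i = h (i - m)" for i
  let ?q = "m + card (V - S)"
  have u: "u i \<in> V" "u i \<notin> S" if "m \<le> i" "i < ?q" for i
  proof -
    have "u i \<in> h ` {0..<card (V - S)}" using that by (auto simp: u_def)
    then show "u i \<in> V" "u i \<notin> S" using h by (auto simp: bij_betw_def)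
  qed
  have uinj: "u i \<noteq> u j" if "m \<le> i" "m \<le> j" "i < ?q" "j < ?q" "i \<noteq> j" for i j
  proof
    assume "u i = u j"
    then have "i - m = j - m"
      using h that by (intro inj_onD[of h "{0..<card (V - S)}"]) (auto simp: u_def bij_betw_def)
    then show False using that by simp
  qed
  define Ds where "Ds i = (if i < m then (S, F i) else (insert (u i) S, S \<times> {u i} \<union> {u i} \<times> S))" for i
  have Dlt: "Ds i = (S, F i)" if "i < m" for i using that by (simp add: Ds_def)
  have Dge: "Ds i = (insert (u i) S, S \<times> {u i} \<union> {u i} \<times> S)" if "m \<le> i" for i
    using that by (simp add: Ds_def)
  note FD = arc_splitD[OF F]
  have "subdigraph (fst (Ds i)) (snd (Ds i)) V (V \<times> V - Id) \<and> strong (fst (Ds i)) (snd (Ds i)) \<and> S \<subseteq> fst (Ds i)"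
    if "i < ?q" for i
  proof (cases "i < m")
    case True
    then show ?thesis using FD(1,2)[OF True] assms(2) by (auto simp: Dlt subdigraph_def)
  next
    case False
    then have m: "m \<le> i" by simp
    have "(x, y) \<in> (S \<times> {u i} \<union> {u i} \<times> S)\<^sup>*" if "x \<in> S" "y \<in> S" for x y
      by (rule rtrancl_trans[of x "u i"]) (use that in auto)
    then have "strong (insert (u i) S) (S \<times> {u i} \<union> {u i} \<times> S)"
      by (auto simp: strong_def)
    then show ?thesis using u[OF m that] assms(2) by (auto simp: Dge[OF m] subdigraph_def)
  qed
  moreover have "fst (Ds i) \<inter> fst (Ds j) = S \<and> snd (Ds i) \<inter> snd (Ds j) = {}"
    if "i < ?q" "j < ?q" "i < j" for i j
  proof (cases "j < m")
    case True
    then show ?thesis using that FD(3)[of i j] by (auto simp: Dlt)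
  next
    case False
    then have j: "m \<le> j" by simp
    show ?thesis
    proof (cases "i < m")
      case True
      then show ?thesis using u[OF j that(2)] FD(1)[OF True] by (auto simp: Dlt Dge[OF j])
    next
      case False
      then have i: "m \<le> i" by simp
      show ?thesis using u[OF i that(1)] u[OF j that(2)] uinj[OF i j that(1,2)] that(3)
        by (auto simp: Dge[OF i] Dge[OF j])
    qed
  qed
  ultimately have "S_internally_disjoint_family V (V \<times> V - Id) S ?q Ds"
    by (simp add: S_internally_disjoint_family_def)
  then show ?thesis by blast
qed

lemma kappa_k_complete:
  assumes "finite V" "2 \<le> k" "k \<le> card V" "k \<notin> {4, 6}"
  shows "kappa_k V (V \<times> V - Id) k = card V - 1"
proof -
  have D: "digraph V (V \<times> V - Id)" using assms(1) by (auto simp: digraph_def)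
  obtain S where S: "S \<subseteq> V" "card S = k" "kappa_k V (V \<times> V - Id) k = kappa_S V (V \<times> V - Id) S"
    using kappa_k_attained[OF D assms(2,3)] by blast
  have finS: "finite S" using S(1) assms(1) by (rule finite_subset)
  then obtain F where "arc_split S (k - 1) F" using arc_split_complete[of S] S(2) assms by auto
  then obtain Ds where "S_internally_disjoint_family V (V \<times> V - Id) S (k - 1 + card (V - S)) Ds"
    using complete_family[OF assms(1) S(1)] by blast
  moreover have "k - 1 + card (V - S) = card V - 1"
    using S(1,2) finS assms(2,3) by (simp add: card_Diff_subset)
  ultimately have "card V - 1 \<le> kappa_S V (V \<times> V - Id) S"
    using kappa_S_ge[OF D S(1)] S(2) assms(2) by auto
  then show ?thesis using S(3) kappa_k_le[OF D assms(2,3)] by simp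
qed

lemma digraph_iso_complete_iff:
  assumes "digraph V A" "card V = n"
  shows "digraph_iso V A {0..<n} (complete_digraph_arcs n) \<longleftrightarrow> A = V \<times> V - Id"
proof
  assume "digraph_iso V A {0..<n} (complete_digraph_arcs n)"
  then obtain f where f: "bij_betw f V {0..<n}"
    "\<forall>u\<in>V. \<forall>v\<in>V. (u, v) \<in> A \<longleftrightarrow> (f u, f v) \<in> complete_digraph_arcs n"
    by (auto simp: digraph_iso_def)
  have "(u, v) \<in> A \<longleftrightarrow> u \<noteq> v" if "u \<in> V" "v \<in> V" for u v
  proof -
    have "f u \<in> {0..<n}" "f v \<in> {0..<n}" using f(1) that by (auto simp: bij_betw_def)
    moreover have "f u = f v \<longleftrightarrow> u = v" using f(1) that by (auto simp: bij_betw_def inj_on_def)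
    ultimately show ?thesis using f(2) that by (auto simp: complete_digraph_arcs_def)
  qed
  then show "A = V \<times> V - Id" using assms(1) by (auto simp: digraph_def)
next
  assume A: "A = V \<times> V - Id"
  obtain f where f: "bij_betw f V {0..<n}"
    using ex_bij_betw_finite_nat[of V] assms by (auto simp: digraph_def)
  have "(u, v) \<in> A \<longleftrightarrow> (f u, f v) \<in> complete_digraph_arcs n" if "u \<in> V" "v \<in> V" for u v
  proof -
    have "f u \<in> {0..<n}" "f v \<in> {0..<n}" using f(1) that by (auto simp: bij_betw_def)
    moreover have "f u = f v \<longleftrightarrow> u = v" using f(1) that by (auto simp: bij_betw_def inj_on_def)
    ultimately show ?thesis using that by (auto simp: A complete_digraph_arcs_def)
  qed
  then show "digraph_iso V A {0..<n} (complete_digraph_arcs n)"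
    using f by (auto simp: digraph_iso_def)
qed

text \<open>Sharpness of the lower bound: out-degree 1 at vertex 0 allows only one member, and
  strongness provides one.\<close>

lemma kappa_k_directed_cycle:
  assumes "2 \<le> k" "k \<le> n"
  defines "B \<equiv> {(i, Suc i mod n) |i. i < n}"
  shows "digraph {0..<n} B" "strong {0..<n} B" "kappa_k {0..<n} B k = 1"
proof -
  have n: "2 \<le> n" using assms by simp
  have "Suc i mod n \<noteq> i" if "i < n" for i
    using n that by (cases "Suc i = n") auto
  then show D: "digraph {0..<n} B"
    using n by (force simp: digraph_def B_def)
  show str: "strong {0..<n} B"
  proof (rule strong_if_cyclic[where z = id and m = "n - 1"])
    fix i assume "i < n - 1"
    then show "(id i, id (Suc i)) \<in> B" by (auto simp: B_def intro!: exI[of _ i])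
  next
    show "(id (n - 1), id 0) \<in> B" using n by (auto simp: B_def intro!: exI[of _ "n - 1"])
  next
    show "{0..<n} \<subseteq> id ` {..n - 1}" by auto
  qed
  have "B `` {0} = {Suc 0 mod n}" using n by (auto simp: B_def)
  then have "kappa_k {0..<n} B k \<le> 1"
    using kappa_k_le_out_degree[OF D assms(1), of 0] assms(2) n by simp
  then show "kappa_k {0..<n} B k = 1"
    using kappa_k_pos[OF D assms(1) _ str] assms(2) by simp
qed

theorem theorem3p5:
  fixes V :: "'a set" and A :: "('a \<times> 'a) set" and n k :: nat
  assumes "2 \<le> k" and "k \<le> n"
    and "digraph V A" and "card V = n" and "strong V A"
  shows "1 \<le> kappa_k V A k \<and> kappa_k V A k \<le> n - 1
    \<and> (kappa_k V A k = n - 1 \<longleftrightarrow>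
          digraph_iso V A {0..<n} (complete_digraph_arcs n) \<and> k \<notin> {4, 6})
    \<and> (\<exists>(W :: nat set) B. digraph W B \<and> card W = n \<and> strong W B \<and> kappa_k W B k = 1)
    \<and> (k \<notin> {4, 6} \<longrightarrow>
         (\<exists>(W :: nat set) B. digraph W B \<and> card W = n \<and> strong W B \<and> kappa_k W B k = n - 1))"
proof (intro conjI impI)
  have k: "k \<le> card V" using assms by simp
  note K = assms(3,1) k
  show "1 \<le> kappa_k V A k" using kappa_k_pos[OF K] assms(5) .
  show "kappa_k V A k \<le> n - 1" using kappa_k_le[OF K] assms(4) by simp
  show "kappa_k V A k = n - 1 \<longleftrightarrow>
      digraph_iso V A {0..<n} (complete_digraph_arcs n) \<and> k \<notin> {4, 6}"
    using arcs_complete_if_kappa_k_max[OF K] exceptional_kappa_k[OF K] assms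
      kappa_k_complete[of V k] digraph_iso_complete_iff[OF assms(3,4)]
    by (auto simp: digraph_def)
  show "\<exists>(W :: nat set) B. digraph W B \<and> card W = n \<and> strong W B \<and> kappa_k W B k = 1"
    by (intro exI conjI, rule kappa_k_directed_cycle(1)[OF assms(1,2)], simp,
      (rule kappa_k_directed_cycle[OF assms(1,2)])+)
  \<comment> \<open>The complete digraph witnesses sharpness of the upper bound. For
    \<open>k\<close> equal to 4 or 6 the characterization shows that no strong digraph attains n -
    1, hence the restriction on \<open>k\<close>.\<close>
  let ?B = "{0..<n} \<times> {0..<n} - Id"
  assume "k \<notin> {4, 6}"
  then have "kappa_k {0..<n} ?B k = n - 1"
    using kappa_k_complete[of "{0..<n}" k] assms(1,2) by simp
  moreover have "strong {0..<n} ?B"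
    unfolding strong_def
  proof (intro ballI)
    fix u v assume "u \<in> {0..<n}" "v \<in> {0..<n}"
    then show "(u, v) \<in> ?B\<^sup>*" by (cases "u = v") auto
  qed
  moreover have "digraph {0..<n} ?B" by (auto simp: digraph_def)
  moreover have "card {0..<n} = n" by simp
  ultimately show "\<exists>(W :: nat set) B. digraph W B \<and> card W = n \<and> strong W B \<and> kappa_k W B k = n - 1"
    by blast
qed

end
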